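(* Let $\Omega=\{1,\dots,K\}$ and let $g:2^\Omega\to\mathbb{R}_+$ satisfy the order property and the submodular property. Let $\mathcal{P}(g)=\{\mathbf{r}\in\mathbb{R}_+^K:\ \sum_{i\in S}r_i\le g(S)\ \ \forall S\subseteq\Omega\}$. Then the max-min fair point in $\mathcal{P}(g)$ can be computed in $O(K^2)$ time, where each evaluation of $g$ on a subset of $\Omega$ and each arithmetic operation or comparison of real numbers counts as one unit of time.
   Context: $\mathbb{R}_+$ denotes the nonnegative reals. Submodular property: $g(S)+g(T)\ge g(S\cap T)+g(S\cup T)$ for all $S,T\subseteq\Omega$. Order property: for all $A,B,C\subseteq\Omega$ with $|A|=|B|$ and $A\cap C=\emptyset=B\cap C$, $g(A)\le g(B)$ implies $g(A\cup C)\le g(B\cup C)$. A point $\mathbf{r}^{MM}\in\mathcal{R}$ of a set $\mathcal{R}\subseteq\mathbb{R}_+^K$ is max-min fair in $\mathcal{R}$ if for every $\mathbf{r}\in\mathcal{R}$ and every $i$ with $r_i>r_i^{MM}$ there is $j\in\Omega$ with $r_j<r_j^{MM}\le r_i^{MM}$. *)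

theory Defs
  imports Complex_Main "HOL-Library.FuncSet" "HOL-Library.Landau_Symbols"
begin

definition submodular_on :: "nat set \<Rightarrow> (nat set \<Rightarrow> real) \<Rightarrow> bool" where
  "submodular_on \<Omega> g \<longleftrightarrow>
     (\<forall>S T. S \<subseteq> \<Omega> \<longrightarrow> T \<subseteq> \<Omega> \<longrightarrow> g S + g T \<ge> g (S \<inter> T) + g (S \<union> T))"

definition order_property_on :: "nat set \<Rightarrow> (nat set \<Rightarrow> real) \<Rightarrow> bool" where
  "order_property_on \<Omega> g \<longleftrightarrow>
     (\<forall>A B C. A \<subseteq> \<Omega> \<longrightarrow> B \<subseteq> \<Omega> \<longrightarrow> C \<subseteq> \<Omega> \<longrightarrow> card A = card B \<longrightarrow>
        A \<inter> C = {} \<longrightarrow> B \<inter> C = {} \<longrightarrow> g A \<le> g B \<longrightarrow> g (A \<union> C) \<le> g (B \<union> C))"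

text \<open>Points of the nonnegative orthant indexed by a finite set are extensional functions,
  so that equality of points is equality of coordinates.\<close>

definition rate_region :: "nat set \<Rightarrow> (nat set \<Rightarrow> real) \<Rightarrow> (nat \<Rightarrow> real) set" where
  "rate_region \<Omega> g = {r \<in> \<Omega> \<rightarrow>\<^sub>E {0..}. \<forall>S\<subseteq>\<Omega>. (\<Sum>i\<in>S. r i) \<le> g S}"

definition max_min_fair :: "nat set \<Rightarrow> (nat \<Rightarrow> real) set \<Rightarrow> (nat \<Rightarrow> real) \<Rightarrow> bool" where
  "max_min_fair \<Omega> R x \<longleftrightarrow>
     x \<in> R \<and> (\<forall>r\<in>R. \<forall>i\<in>\<Omega>. r i > x i \<longrightarrow> (\<exists>j\<in>\<Omega>. r j < x j \<and> x j \<le> x i))"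

text \<open>Model of computation: a structured real RAM with an oracle for the set function.
  The memory consists of scalars and arrays holding natural numbers (used for indexing and
  control) and scalars and arrays holding real numbers. There is no conversion between the
  two sorts, and the only real constants are 0 and 1.\<close>

type_synonym vname = string

record memory =
  nvar :: "vname \<Rightarrow> nat"
  narr :: "vname \<Rightarrow> nat \<Rightarrow> nat"
  rvar :: "vname \<Rightarrow> real"
  rarr :: "vname \<Rightarrow> nat \<Rightarrow> real"

datatype nexp =
    NConst nat
  | NVar vname
  | NArr vname nexp
  | NPlus nexp nexp
  | NMinus nexp nexp

datatype rexp =
    RZero
  | ROne
  | RVar vname
  | RArr vname nexp
  | RPlus rexp rexp
  | RMinus rexp rexp
  | RTimes rexp rexp
  | RDivide rexp rexp

datatype bexp =
    NLess nexp nexp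
  | RLess rexp rexp
  | BNot bexp
  | BAnd bexp bexp

datatype com =
    Skip
  | AssignNVar vname nexp
  | AssignNArr vname nexp nexp
  | AssignRVar vname rexp
  | AssignRArr vname nexp rexp
  | Query vname vname
  | Seq com com
  | If bexp com com
  | While bexp com

primrec nval :: "nexp \<Rightarrow> memory \<Rightarrow> nat" where
  "nval (NConst n) s = n"
| "nval (NVar x) s = nvar s x"
| "nval (NArr a e) s = narr s a (nval e s)"
| "nval (NPlus e f) s = nval e s + nval f s"
| "nval (NMinus e f) s = nval e s - nval f s"

primrec rval :: "rexp \<Rightarrow> memory \<Rightarrow> real" where
  "rval RZero s = 0"
| "rval ROne s = 1"
| "rval (RVar x) s = rvar s x"
| "rval (RArr a e) s = rarr s a (nval e s)"
| "rval (RPlus e f) s = rval e s + rval f s"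
| "rval (RMinus e f) s = rval e s - rval f s"
| "rval (RTimes e f) s = rval e s * rval f s"
| "rval (RDivide e f) s = rval e s / rval f s"

primrec bval :: "bexp \<Rightarrow> memory \<Rightarrow> bool" where
  "bval (NLess e f) s \<longleftrightarrow> nval e s < nval f s"
| "bval (RLess e f) s \<longleftrightarrow> rval e s < rval f s"
| "bval (BNot b) s \<longleftrightarrow> \<not> bval b s"
| "bval (BAnd b c) s \<longleftrightarrow> bval b s \<and> bval c s"

text \<open>Every constant, memory access, operation and comparison in an expression costs one
  unit; conjunction is not short-circuited.\<close>

primrec ncost :: "nexp \<Rightarrow> nat" where
  "ncost (NConst n) = 1"
| "ncost (NVar x) = 1"
| "ncost (NArr a e) = 1 + ncost e"
| "ncost (NPlus e f) = 1 + ncost e + ncost f"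
| "ncost (NMinus e f) = 1 + ncost e + ncost f"

primrec rcost :: "rexp \<Rightarrow> nat" where
  "rcost RZero = 1"
| "rcost ROne = 1"
| "rcost (RVar x) = 1"
| "rcost (RArr a e) = 1 + ncost e"
| "rcost (RPlus e f) = 1 + rcost e + rcost f"
| "rcost (RMinus e f) = 1 + rcost e + rcost f"
| "rcost (RTimes e f) = 1 + rcost e + rcost f"
| "rcost (RDivide e f) = 1 + rcost e + rcost f"

primrec bcost :: "bexp \<Rightarrow> nat" where
  "bcost (NLess e f) = 1 + ncost e + ncost f"
| "bcost (RLess e f) = 1 + rcost e + rcost f"
| "bcost (BNot b) = 1 + bcost b"
| "bcost (BAnd b c) = 1 + bcost b + bcost c"

text \<open>\<open>exec \<Omega> g c s t s'\<close>: started in memory \<open>s\<close>, program \<open>c\<close> halts in memory \<open>s'\<close> after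
  \<open>t\<close> units of time. \<open>Query x a\<close> assigns to the real scalar \<open>x\<close> the value of the oracle \<open>g\<close>
  on the subset of \<open>\<Omega>\<close> whose membership vector is stored in the array \<open>a\<close>. The program
  has no other access to \<open>\<Omega>\<close> and \<open>g\<close>.\<close>

inductive exec ::
  "nat set \<Rightarrow> (nat set \<Rightarrow> real) \<Rightarrow> com \<Rightarrow> memory \<Rightarrow> nat \<Rightarrow> memory \<Rightarrow> bool"
  for \<Omega> :: "nat set" and g :: "nat set \<Rightarrow> real"
where
  Skip: "exec \<Omega> g Skip s 1 s"
| AssignNVar: "exec \<Omega> g (AssignNVar x e) s (1 + ncost e)
    (s\<lparr>nvar := (nvar s)(x := nval e s)\<rparr>)"
| AssignNArr: "exec \<Omega> g (AssignNArr a i e) s (1 + ncost i + ncost e)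
    (s\<lparr>narr := (narr s)(a := (narr s a)(nval i s := nval e s))\<rparr>)"
| AssignRVar: "exec \<Omega> g (AssignRVar x e) s (1 + rcost e)
    (s\<lparr>rvar := (rvar s)(x := rval e s)\<rparr>)"
| AssignRArr: "exec \<Omega> g (AssignRArr a i e) s (1 + ncost i + rcost e)
    (s\<lparr>rarr := (rarr s)(a := (rarr s a)(nval i s := rval e s))\<rparr>)"
| Query: "exec \<Omega> g (Query x a) s 1
    (s\<lparr>rvar := (rvar s)(x := g {i \<in> \<Omega>. narr s a i \<noteq> 0})\<rparr>)"
| Seq: "exec \<Omega> g c s t s' \<Longrightarrow> exec \<Omega> g d s' u s'' \<Longrightarrow> exec \<Omega> g (Seq c d) s (t + u) s''"
| IfTrue: "bval b s \<Longrightarrow> exec \<Omega> g c s t s' \<Longrightarrow> exec \<Omega> g (If b c d) s (1 + bcost b + t) s'"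
| IfFalse: "\<not> bval b s \<Longrightarrow> exec \<Omega> g d s t s' \<Longrightarrow> exec \<Omega> g (If b c d) s (1 + bcost b + t) s'"
| WhileFalse: "\<not> bval b s \<Longrightarrow> exec \<Omega> g (While b c) s (1 + bcost b) s"
| WhileTrue: "bval b s \<Longrightarrow> exec \<Omega> g c s t s' \<Longrightarrow> exec \<Omega> g (While b c) s' u s'' \<Longrightarrow>
    exec \<Omega> g (While b c) s (1 + bcost b + t + u) s''"

inductive_cases SkipE: "exec \<Omega> g Skip s t s'"
inductive_cases AssignNVarE: "exec \<Omega> g (AssignNVar x e) s t s'"
inductive_cases AssignNArrE: "exec \<Omega> g (AssignNArr a i e) s t s'"
inductive_cases AssignRVarE: "exec \<Omega> g (AssignRVar x e) s t s'"
inductive_cases AssignRArrE: "exec \<Omega> g (AssignRArr a i e) s t s'"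
inductive_cases QueryE: "exec \<Omega> g (Query x a) s t s'"
inductive_cases SeqE: "exec \<Omega> g (Seq c d) s t s'"
inductive_cases IfE: "exec \<Omega> g (If b c d) s t s'"
inductive_cases WhileE: "exec \<Omega> g (While b c) s t s'"

lemma exec_deterministic:
  assumes "exec \<Omega> g c s t s'" and "exec \<Omega> g c s u s''"
  shows "t = u \<and> s' = s''"
  using assms
proof (induction arbitrary: u s'' rule: exec.induct)
  case (Seq c s t s' d v s1)
  from Seq.prems show ?case by (rule SeqE) (auto dest: Seq.IH)
next
  case (IfTrue b s c t s' d)
  from IfTrue.prems show ?case by (rule IfE) (auto simp: IfTrue.hyps(1) dest: IfTrue.IH)
next
  case (IfFalse b s d t s' c)
  from IfFalse.prems show ?case by (rule IfE) (auto simp: IfFalse.hyps(1) dest: IfFalse.IH)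
next
  case (WhileFalse b s c)
  from WhileFalse.prems show ?case by (rule WhileE) (simp_all add: WhileFalse.hyps(1))
next
  case (WhileTrue b s c t s' v s1)
  from WhileTrue.prems show ?case
    by (rule WhileE) (auto simp: WhileTrue.hyps(1) dest: WhileTrue.IH)
qed (erule SkipE AssignNVarE AssignNArrE AssignRVarE AssignRArrE QueryE; simp)+

text \<open>The number \<open>K\<close> is given in a natural-number scalar, all other memory is zero; the
  output point is read off entries \<open>1, ..., K\<close> of a real array.\<close>

definition input_memory :: "nat \<Rightarrow> memory" where
  "input_memory K =
     \<lparr>nvar = (\<lambda>_. 0)(''K'' := K), narr = (\<lambda>_ _. 0), rvar = (\<lambda>_. 0), rarr = (\<lambda>_ _. 0)\<rparr>"

definition output_point :: "nat \<Rightarrow> memory \<Rightarrow> nat \<Rightarrow> real" where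
  "output_point K s = restrict (rarr s ''r'') {1..K}"

lemma max_min_fair_unique:
  assumes "finite \<Omega>" and "R \<subseteq> \<Omega> \<rightarrow>\<^sub>E {0..}"
    and x: "max_min_fair \<Omega> R x" and y: "max_min_fair \<Omega> R y"
  shows "x = y"
proof (rule ccontr)
  assume "x \<noteq> y"
  define D where "D = {i \<in> \<Omega>. x i \<noteq> y i}"
  have "x \<in> \<Omega> \<rightarrow>\<^sub>E {0..}" "y \<in> \<Omega> \<rightarrow>\<^sub>E {0..}"
    using assms unfolding max_min_fair_def by blast+
  with \<open>x \<noteq> y\<close> have "D \<noteq> {}"
    unfolding D_def using PiE_ext by blast
  moreover have "finite D" unfolding D_def using assms(1) by simp
  ultimately obtain i where i: "i \<in> D"
    and least: "\<And>j. j \<in> D \<Longrightarrow> min (x i) (y i) \<le> min (x j) (y j)"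
    using arg_min_if_finite[of D "\<lambda>j. min (x j) (y j)"] by (metis not_less)
  have aux: False if u: "max_min_fair \<Omega> R u" and "v \<in> R" and "u i < v i"
    and uv: "\<And>j. j \<in> \<Omega> \<Longrightarrow> u j \<noteq> v j \<Longrightarrow> min (u i) (v i) \<le> min (u j) (v j)" for u v
  proof -
    have "i \<in> \<Omega>" using i by (simp add: D_def)
    then obtain j where "j \<in> \<Omega>" "v j < u j" "u j \<le> u i"
      using u \<open>v \<in> R\<close> \<open>u i < v i\<close> unfolding max_min_fair_def by blast
    with uv[of j] \<open>u i < v i\<close> show False by simp
  qed
  have "x \<in> R" "y \<in> R" using x y by (simp_all add: max_min_fair_def)
  consider "x i < y i" | "y i < x i" using i unfolding D_def by force
  then show False
  proof cases
    case 1
    then show False using aux[OF x \<open>y \<in> R\<close>] least by (simp add: D_def)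
  next
    case 2
    moreover have "min (y i) (x i) \<le> min (y j) (x j)" if "j \<in> \<Omega>" "y j \<noteq> x j" for j
      using least[of j] that by (simp add: D_def min.commute)
    ultimately show False using aux[OF y \<open>x \<in> R\<close>] by blast
  qed
qed

end

theory Submission
  imports Defs
begin

text \<open>The order property makes the \<open>m\<close> users with the smallest values \<open>g {i}\<close> a minimiser of \<open>g\<close> among
  all sets of size \<open>m\<close>. Hence, after sorting the users by \<open>g {i}\<close>, water filling only has to look at
  the \<open>K\<close> prefixes: with \<open>G m\<close> the value of \<open>g\<close> on the first \<open>m\<close> users and \<open>h\<close> the total rate of
  the first \<open>a\<close> users, user \<open>a + 1\<close> receives the least of the slopes \<open>(G b - h) / (b - a)\<close>, \<open>b > a\<close>.
  The rates are thus the slopes of the lower convex hull of \<open>G\<close>. They increase along the order, and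
  the prefixes at the vertices of the hull are tight, which bounds the rates of all users in them.
  Selection sort and the \<open>K\<close> searches for the least slope take quadratic time.\<close>

section \<open>The greedy point\<close>

text \<open>\<open>l\<close> is indexed by position in the order \<open>p\<close>. Written without
  division, \<open>bound\<close> and \<open>attained\<close> say that \<open>l (Suc a)\<close> is
  the least slope from the total rate of the first \<open>a\<close> positions to a later prefix
  value.\<close>

locale greedy_rates =
  fixes K :: nat and g :: "nat set \<Rightarrow> real" and p :: "nat \<Rightarrow> nat" and l :: "nat \<Rightarrow> real"
  assumes nonneg: "S \<subseteq> {1..K} \<Longrightarrow> 0 \<le> g S"
    and order: "order_property_on {1..K} g"
    and submodular: "submodular_on {1..K} g"
    and bij: "bij_betw p {1..K} {1..K}"
    and sorted: "\<lbrakk>1 \<le> a; a \<le> b; b \<le> K\<rbrakk> \<Longrightarrow> g {p a} \<le> g {p b}"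
    and bound: "\<lbrakk>a < b; b \<le> K\<rbrakk> \<Longrightarrow>
      (\<Sum>c=1..a. l c) + real (b - a) * l (Suc a) \<le> g (p ` {1..b})"
    and attained: "a < K \<Longrightarrow> \<exists>b. a < b \<and> b \<le> K \<and>
      (\<Sum>c=1..a. l c) + real (b - a) * l (Suc a) = g (p ` {1..b})"
begin

abbreviation P :: "nat \<Rightarrow> nat set" where "P m \<equiv> p ` {1..m}"
abbreviation h :: "nat \<Rightarrow> real" where "h m \<equiv> \<Sum>c=1..m. l c"

lemma inj: "inj_on p {1..K}"
  using bij by (simp add: bij_betw_def)

lemma P_subset: "m \<le> K \<Longrightarrow> P m \<subseteq> {1..K}"
  using bij by (fastforce simp: bij_betw_def)

lemma card_P: "m \<le> K \<Longrightarrow> card (P m) = m"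
  using inj_on_subset[OF inj, of "{1..m}"] by (simp add: card_image)

lemma P_K: "P K = {1..K}"
  using bij by (simp add: bij_betw_def)

lemma P_Suc: "P (Suc m) = P m \<union> {p (Suc m)}"
  by (auto simp: atLeastAtMostSuc_conv)

lemma p_in_P_iff: "\<lbrakk>1 \<le> i; i \<le> K; m \<le> K\<rbrakk> \<Longrightarrow> p i \<in> P m \<longleftrightarrow> i \<le> m"
  using inj_on_image_mem_iff[OF inj, of i "{1..m}"] by auto

lemma index_exists:
  assumes "x \<in> {1..K}"
  obtains i where "1 \<le> i" "i \<le> K" "x = p i"
  using assms P_K by (metis atLeastAtMost_iff imageE)

lemma orderD:
  assumes "A \<subseteq> {1..K}" "B \<subseteq> {1..K}" "C \<subseteq> {1..K}" "card A = card B"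
    "A \<inter> C = {}" "B \<inter> C = {}" "g A \<le> g B"
  shows "g (A \<union> C) \<le> g (B \<union> C)"
  using order assms unfolding order_property_on_def by blast

text \<open>Induct on the size and drop the element \<open>p M\<close> of largest position. The
  induction hypothesis compares the rest with \<open>P m\<close>, and the order property puts
  \<open>p M\<close> back on both sides. A second use of it, with \<open>P m\<close> as the common
  part, exchanges \<open>p M\<close> for \<open>p (Suc m)\<close>, whose singleton value is no
  larger.\<close>

lemma prefix_minimal:
  assumes "A \<subseteq> {1..K}"
  shows "g (P (card A)) \<le> g A"
  using assms
proof (induction "card A" arbitrary: A)
  case 0
  then have "A = {}" using finite_subset by fastforce
  then show ?case by simp
next
  case (Suc m)
  define I where "I = {i \<in> {1..K}. p i \<in> A}"
  have A: "A = p ` I"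
  proof
    show "A \<subseteq> p ` I"
    proof
      fix x assume "x \<in> A"
      moreover from this obtain i where "1 \<le> i" "i \<le> K" "x = p i"
        using index_exists Suc.prems by blast
      ultimately show "x \<in> p ` I" by (simp add: I_def)
    qed
  qed (auto simp: I_def)
  have fin: "finite I" by (simp add: I_def)
  have "inj_on p I" by (rule inj_on_subset[OF inj]) (auto simp: I_def)
  then have "card I = Suc m" using Suc.hyps(2) A card_image by metis
  then have ne: "I \<noteq> {}" by auto
  define M where "M = Max I"
  have M: "M \<in> I" using fin ne by (simp add: M_def)
  then have MK: "1 \<le> M" "M \<le> K" "p M \<in> A" by (auto simp: I_def)
  have "I \<subseteq> {1..M}" using fin by (auto simp: M_def I_def)
  \<comment> \<open>\<open>Suc m\<close> different positions lie in \<open>{1..M}\<close>. Hence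
    \<open>p M\<close> is outside \<open>P m\<close>, and \<open>sorted\<close> applies to
    \<open>Suc m\<close> and \<open>M\<close>.\<close>
  then have Mm: "Suc m \<le> M"
    using \<open>card I = Suc m\<close> card_mono[of "{1..M}" I] by simp
  define A' where "A' = A - {p M}"
  have "finite A" using Suc.prems finite_subset by blast
  then have cA': "card A' = m" using MK Suc.hyps(2) by (simp add: A'_def)
  have A'K: "A' \<subseteq> {1..K}" using Suc.prems by (auto simp: A'_def)
  have "g (P m) \<le> g A'" using Suc.hyps(1)[of A'] cA' A'K by simp
  then have "g (P m \<union> {p M}) \<le> g (A' \<union> {p M})"
    using orderD[of "P m" A' "{p M}"] A'K P_subset[of m] card_P[of m] cA' MK Mm
      p_in_P_iff[of M m] Suc.prems by (auto simp: A'_def)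
  moreover have "g ({p (Suc m)} \<union> P m) \<le> g ({p M} \<union> P m)"
  proof (rule orderD)
    show "{p (Suc m)} \<subseteq> {1..K}" using P_subset[of "Suc m"] P_Suc[of m] Mm MK by simp
    show "{p M} \<subseteq> {1..K}" using MK Suc.prems by auto
    show "P m \<subseteq> {1..K}" using P_subset[of m] Mm MK by auto
    show "{p (Suc m)} \<inter> P m = {}" "{p M} \<inter> P m = {}"
      using p_in_P_iff[of "Suc m" m] p_in_P_iff[of M m] Mm MK by auto
    show "g {p (Suc m)} \<le> g {p M}" using sorted Mm MK by simp
  qed simp
  moreover have "A' \<union> {p M} = A" using MK by (auto simp: A'_def)
  ultimately show ?case using Suc.hyps(2) P_Suc[of m] by (simp add: Un_commute)
qed

section \<open>Monotone rates and tight prefixes\<close>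

lemma h_le_prefix:
  assumes "1 \<le> m" "m \<le> K"
  shows "h m \<le> g (P m)"
proof -
  obtain a where "m = Suc a" using assms by (cases m) auto
  then show ?thesis using bound[of a m] assms by simp
qed

text \<open>The \<open>b\<close> attaining the slope at \<open>Suc a\<close> was already a candidate
  at \<open>a\<close>. Comparing the two relations for it leaves \<open>b - Suc a\<close> times the
  claim.\<close>

lemma l_mono_Suc:
  assumes "Suc (Suc a) \<le> K"
  shows "l (Suc a) \<le> l (Suc (Suc a))"
proof -
  obtain b where b: "Suc a < b" "b \<le> K" "h (Suc a) + real (b - Suc a) * l (Suc (Suc a)) = g (P b)"
    using attained[of "Suc a"] assms by auto
  have "h a + real (b - a) * l (Suc a) \<le> g (P b)" using bound[of a b] b by simp
  moreover have "real (b - a) = real (b - Suc a) + 1" using b by auto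
  ultimately have "real (b - Suc a) * l (Suc a) \<le> real (b - Suc a) * l (Suc (Suc a))"
    using b(3) by (simp add: algebra_simps)
  then show ?thesis using b(1) by simp
qed

lemma l_mono:
  assumes "1 \<le> i" "i \<le> j" "j \<le> K"
  shows "l i \<le> l j"
  using assms(2,3)
proof (induction j rule: dec_induct)
  case (step n)
  then obtain a where "n = Suc a" using assms(1) by (cases n) auto
  then show ?case using step l_mono_Suc[of a] by simp
qed simp

text \<open>As \<open>h 0 = 0\<close>, the first rate is a quotient \<open>g (P b) / b\<close>;
  later rates are no smaller.\<close>

lemma l_nonneg:
  assumes "1 \<le> i" "i \<le> K"
  shows "0 \<le> l i"
proof -
  obtain b where "0 < b" "b \<le> K" "real b * l 1 = g (P b)"
    using attained[of 0] assms by auto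
  then have "0 \<le> l 1" using nonneg[OF P_subset[of b]]
    by (metis linorder_not_le mult_pos_neg of_nat_0_less_iff)
  then show ?thesis using l_mono[of 1 i] assms by simp
qed

text \<open>The minimising \<open>b\<close> ends a segment of the hull: \<open>h\<close> runs
  straight from \<open>a\<close> to the tight value at \<open>b\<close>. In between,
  \<open>l_mono\<close> keeps the rates from falling, and \<open>bound\<close> with target
  \<open>b\<close> keeps them from rising.\<close>

lemma next_tight:
  assumes "a < K"
  obtains b where "a < b" "b \<le> K" "h b = g (P b)"
    "\<And>j. a < j \<Longrightarrow> j \<le> b \<Longrightarrow> l j = l (Suc a)"
    "\<And>j. a \<le> j \<Longrightarrow> j \<le> b \<Longrightarrow> h j = h a + real (j - a) * l (Suc a)"
proof -
  obtain b where b: "a < b" "b \<le> K" "h a + real (b - a) * l (Suc a) = g (P b)"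
    using attained[OF assms] by auto
  have hj: "j \<le> b \<longrightarrow> (a < j \<longrightarrow> l j = l (Suc a)) \<and> h j = h a + real (j - a) * l (Suc a)"
    if "a \<le> j" for j
    using that
  proof (induction j rule: dec_induct)
    case (step n)
    show ?case
    proof
      assume n: "Suc n \<le> b"
      then have hn: "h n = h a + real (n - a) * l (Suc a)" using step by simp
      \<comment> \<open>While \<open>h\<close> is on the line, the slope needed from
        \<open>n\<close> to reach \<open>g (P b)\<close> is still \<open>l (Suc a)\<close>.\<close>
      have "real (b - a) = real (n - a) + real (b - n)" using n step(1) by linarith
      then have "h a + (real (n - a) + real (b - n)) * l (Suc a) = g (P b)" using b(3) by simp
      moreover have "h n + real (b - n) * l (Suc n) \<le> g (P b)" using bound[of n b] n b by simp
      ultimately have "real (b - n) * l (Suc n) \<le> real (b - n) * l (Suc a)"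
        using hn by (simp add: algebra_simps)
      then have "l (Suc n) \<le> l (Suc a)" using n by simp
      moreover have "l (Suc a) \<le> l (Suc n)" using l_mono[of "Suc a" "Suc n"] step(1) n b by simp
      ultimately have "l (Suc n) = l (Suc a)" by simp
      moreover have "real (Suc n - a) = real (n - a) + 1" using step(1) by linarith
      ultimately show "(a < Suc n \<longrightarrow> l (Suc n) = l (Suc a)) \<and>
          h (Suc n) = h a + real (Suc n - a) * l (Suc a)"
        using hn by (simp add: algebra_simps)
    qed
  qed simp
  have "h b = g (P b)" using hj[of b] b by simp
  with b hj show ?thesis using that[of b] by (metis less_imp_le)
qed

section \<open>Feasibility and max-min fairness\<close>

definition r :: "nat \<Rightarrow> real" where
  "r x = l (inv_into {1..K} p x)"

lemma r_p: "\<lbrakk>1 \<le> i; i \<le> K\<rbrakk> \<Longrightarrow> r (p i) = l i"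
  using inj by (simp add: r_def)

lemma sum_r_P: "m \<le> K \<Longrightarrow> (\<Sum>x\<in>P m. r x) = h m"
  using inj_on_subset[OF inj, of "{1..m}"] by (simp add: sum.reindex r_p)

text \<open>Uncrossing \<open>S\<close> with the tight prefix \<open>P a\<close> reduces feasibility to sets between two
  consecutive tight prefixes, where all rates agree and only the cardinality matters.
  The case \<open>a = 0\<close> is separate since \<open>g {}\<close> may be positive.\<close>
lemma feasible_step:
  assumes a: "a = 0 \<or> h a = g (P a)" "a < b" "b \<le> K"
    and IH: "\<And>S. S \<subseteq> P a \<Longrightarrow> (\<Sum>x\<in>S. r x) \<le> g S"
    and lj: "\<And>j. a < j \<Longrightarrow> j \<le> b \<Longrightarrow> l j = l (Suc a)"
    and hj: "\<And>j. a \<le> j \<Longrightarrow> j \<le> b \<Longrightarrow> h j = h a + real (j - a) * l (Suc a)"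
    and S: "S \<subseteq> P b"
  shows "(\<Sum>x\<in>S. r x) \<le> g S"
proof (cases "S \<subseteq> P a")
  case True
  then show ?thesis by (rule IH)
next
  case False
  have PK: "P a \<subseteq> {1..K}" "P b \<subseteq> {1..K}" using P_subset assms(2,3) by auto
  then have SK: "S \<subseteq> {1..K}" using S by auto
  have finS: "finite S" using SK finite_subset by blast
  have "g (S \<inter> P a) + g (S \<union> P a) \<le> g S + g (P a)"
    using submodular SK PK unfolding submodular_on_def by blast
  then have unc: "(\<Sum>x\<in>S \<inter> P a. r x) + g (S \<union> P a) - h a \<le> g S"
    using a(1) IH[of "S \<inter> P a"] by auto
  define m where "m = card (S \<union> P a)"
  have card: "m = a + card (S - P a)"
  proof -
    have "m = card (P a \<union> (S - P a))" by (simp add: m_def Un_commute)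
    also have "\<dots> = card (P a) + card (S - P a)"
      using finS by (subst card_Un_disjoint) auto
    finally show ?thesis using card_P[of a] assms(2,3) by simp
  qed
  have "card (S - P a) > 0" using False finS by (auto simp: card_gt_0_iff)
  moreover have "m \<le> b"
  proof -
    have "S \<union> P a \<subseteq> P b" using S assms(2) by auto
    then have "m \<le> card (P b)" unfolding m_def by (intro card_mono) auto
    then show ?thesis using card_P assms(3) by simp
  qed
  ultimately have m: "a < m" "m \<le> b" using card by auto
  \<comment> \<open>\<open>prefix_minimal\<close> replaces the union by the prefix of the same size,
    and \<open>a < m \<le> b\<close> puts that prefix on the segment where \<open>h\<close> is
    linear.\<close>
  have "h m \<le> g (S \<union> P a)"
    using prefix_minimal[of "S \<union> P a"] h_le_prefix[of m] m assms(3) SK PK by (simp add: m_def)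
  then have "h a + real (card (S - P a)) * l (Suc a) \<le> g (S \<union> P a)"
    using hj[of m] m card by simp
  moreover have "(\<Sum>x\<in>S - P a. r x) = real (card (S - P a)) * l (Suc a)"
  proof -
    have "r x = l (Suc a)" if "x \<in> S - P a" for x
    proof -
      have "x \<in> P b" using DiffD1[OF that] S by (rule subsetD[rotated])
      then obtain i where i: "x = p i" "1 \<le> i" "i \<le> b" by auto
      have "x \<notin> P a" using that by simp
      moreover have "a \<le> K" "i \<le> K" using i assms(2,3) by linarith+
      ultimately have "a < i" using p_in_P_iff[of i a] i by (metis not_le)
      then show ?thesis using i lj[of i] r_p[of i] assms(3) by simp
    qed
    then show ?thesis by simp
  qed
  moreover have "(\<Sum>x\<in>S. r x) = (\<Sum>x\<in>S \<inter> P a. r x) + (\<Sum>x\<in>S - P a. r x)"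
    using finS by (metis sum.Int_Diff)
  ultimately show ?thesis using unc by simp
qed

text \<open>Feasibility passes from each tight prefix to the next one supplied by
  \<open>next_tight\<close>, starting from the empty prefix and ending at
  \<open>P K\<close>.\<close>

lemma feasible:
  assumes "S \<subseteq> {1..K}"
  shows "(\<Sum>x\<in>S. r x) \<le> g S"
proof -
  have "\<forall>S \<subseteq> P K. (\<Sum>x\<in>S. r x) \<le> g S"
    if "a \<le> K" "a = 0 \<or> h a = g (P a)" "\<forall>S \<subseteq> P a. (\<Sum>x\<in>S. r x) \<le> g S" for a
    using that
  proof (induction "K - a" arbitrary: a rule: less_induct)
    case less
    show ?case
    proof (cases "a = K")
      case True
      then show ?thesis using less by simp
    next
      case False
      then have "a < K" using less by simp
      from next_tight[OF this] obtain b where b: "a < b" "b \<le> K" "h b = g (P b)"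
        "\<And>j. a < j \<Longrightarrow> j \<le> b \<Longrightarrow> l j = l (Suc a)"
        "\<And>j. a \<le> j \<Longrightarrow> j \<le> b \<Longrightarrow> h j = h a + real (j - a) * l (Suc a)"
        by metis
      have "\<forall>S \<subseteq> P b. (\<Sum>x\<in>S. r x) \<le> g S"
        using feasible_step[OF less.prems(2) b(1,2)] less.prems(3) b(4,5) by blast
      then show ?thesis using less.hyps[OF _ b(2) disjI2[OF b(3)]] b(1) \<open>a < K\<close> by (metis diff_less_mono2)
    qed
  qed
  \<comment> \<open>The only constraint on the empty prefix is \<open>0 \<le> g {}\<close>.\<close>
  from this[of 0] nonneg[of "{}"] show ?thesis using assms P_K by simp
qed

text \<open>Each user lies in a tight prefix in which no rate exceeds its own.\<close>
lemma max_min_fair_r: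
  assumes "\<And>i. 1 \<le> i \<Longrightarrow> i \<le> K \<Longrightarrow> q (p i) = l i"
  shows "max_min_fair {1..K} (rate_region {1..K} g) (restrict q {1..K})"
  unfolding max_min_fair_def
proof (intro conjI ballI impI)
  have q: "restrict q {1..K} x = r x" if "x \<in> {1..K}" for x
    using that index_exists[of x] assms r_p by (metis restrict_apply')
  have "0 \<le> r x" if "x \<in> {1..K}" for x
    using that index_exists[of x] r_p l_nonneg by metis
  moreover have "(\<Sum>x\<in>S. restrict q {1..K} x) \<le> g S" if "S \<subseteq> {1..K}" for S
  proof -
    have "(\<Sum>x\<in>S. restrict q {1..K} x) = (\<Sum>x\<in>S. r x)"
      using that q by (intro sum.cong) auto
    then show ?thesis using feasible that by simp
  qed
  ultimately show "restrict q {1..K} \<in> rate_region {1..K} g"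
    unfolding rate_region_def using q by auto
  fix y x
  assume y: "y \<in> rate_region {1..K} g" and x: "x \<in> {1..K}" and less: "restrict q {1..K} x < y x"
  obtain i where i: "1 \<le> i" "i \<le> K" "x = p i" using index_exists[OF x] by blast
  then obtain a where a: "i = Suc a" "a < K" by (cases i) auto
  obtain b where b: "a < b" "b \<le> K" "h b = g (P b)"
    "\<And>j. a < j \<Longrightarrow> j \<le> b \<Longrightarrow> l j = l (Suc a)"
    using next_tight[OF a(2)] by metis
  have PK: "P b \<subseteq> {1..K}" using P_subset b(2) by simp
  \<comment> \<open>\<open>P b\<close> is tight for \<open>r\<close>, so \<open>y\<close> cannot
    have a larger total there. User \<open>x\<close> gains, so some \<open>z\<close> in
    \<open>P b\<close> loses.\<close>
  have "(\<Sum>x\<in>P b. y x) \<le> (\<Sum>x\<in>P b. r x)"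
    using y PK b sum_r_P[of b] by (auto simp: rate_region_def)
  moreover have "x \<in> P b" using i a b(1) by auto
  moreover have "r x < y x" using less q[OF x] by simp
  ultimately obtain z where z: "z \<in> P b" "y z < r z"
    using sum_strict_mono_ex1[of "P b" r y] by (meson finite_imageI finite_atLeastAtMost not_le)
  then obtain j where j: "1 \<le> j" "j \<le> b" "z = p j" by auto
  have "l j \<le> l b" using l_mono j b(2) by simp
  also have "l b = l i" using b(1) b(4)[of b] a(1) by simp
  finally have "r z \<le> r x" using j i b(2) r_p by simp
  then show "\<exists>j\<in>{1..K}. y j < restrict q {1..K} j \<and> restrict q {1..K} j \<le> restrict q {1..K} x"
    using z q x PK by (metis subsetD)
qed

end

section \<open>Weakest preconditions with a time budget\<close>

text \<open>The postcondition also receives the unused part of the budget, so that \<open>wp\<close> composes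
  equationally along sequences.\<close>
definition wp :: "nat set \<Rightarrow> (nat set \<Rightarrow> real) \<Rightarrow> com \<Rightarrow> (nat \<Rightarrow> memory \<Rightarrow> bool) \<Rightarrow> nat \<Rightarrow> memory \<Rightarrow> bool"
  where "wp \<Omega> g c Q n s \<longleftrightarrow> (\<exists>t s'. exec \<Omega> g c s t s' \<and> t \<le> n \<and> Q (n - t) s')"

text \<open>By determinism a known run is the only run, so \<open>wp\<close> of an atomic command
  can be computed by rewriting.\<close>

lemma wp_exec:
  assumes "exec \<Omega> g c s t s'"
  shows "wp \<Omega> g c Q n s \<longleftrightarrow> t \<le> n \<and> Q (n - t) s'"
  using exec_deterministic[OF assms] assms unfolding wp_def by blast

lemma wp_Seq: "wp \<Omega> g (Seq c d) Q n s \<longleftrightarrow> wp \<Omega> g c (wp \<Omega> g d Q) n s"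
proof
  assume "wp \<Omega> g (Seq c d) Q n s"
  then obtain t s' where "exec \<Omega> g (Seq c d) s t s'" "t \<le> n" "Q (n - t) s'"
    by (auto simp: wp_def)
  then show "wp \<Omega> g c (wp \<Omega> g d Q) n s"
    by (elim SeqE) (force simp: wp_def)
next
  assume "wp \<Omega> g c (wp \<Omega> g d Q) n s"
  then obtain t s' u s'' where "exec \<Omega> g c s t s'" "t \<le> n" "exec \<Omega> g d s' u s''"
    "u \<le> n - t" "Q (n - t - u) s''"
    by (auto simp: wp_def)
  then show "wp \<Omega> g (Seq c d) Q n s"
    unfolding wp_def by (intro exI[of _ "t + u"] exI[of _ s'']) (auto intro: exec.Seq)
qed

lemma wp_If:
  "wp \<Omega> g (If b c d) Q n s \<longleftrightarrow> 1 + bcost b \<le> n \<and>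
     (if bval b s then wp \<Omega> g c Q (n - (1 + bcost b)) s else wp \<Omega> g d Q (n - (1 + bcost b)) s)"
proof
  assume "wp \<Omega> g (If b c d) Q n s"
  then obtain t s' where "exec \<Omega> g (If b c d) s t s'" "t \<le> n" "Q (n - t) s'"
    by (auto simp: wp_def)
  then show "1 + bcost b \<le> n \<and> (if bval b s then wp \<Omega> g c Q (n - (1 + bcost b)) s
      else wp \<Omega> g d Q (n - (1 + bcost b)) s)"
    by (elim IfE) (force simp: wp_def)+
next
  assume *: "1 + bcost b \<le> n \<and> (if bval b s then wp \<Omega> g c Q (n - (1 + bcost b)) s
      else wp \<Omega> g d Q (n - (1 + bcost b)) s)"
  then obtain t s' where "exec \<Omega> g (if bval b s then c else d) s t s'"
    "t \<le> n - (1 + bcost b)" "Q (n - (1 + bcost b) - t) s'"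
    by (auto simp: wp_def split: if_splits)
  moreover from this(1) have "exec \<Omega> g (If b c d) s (1 + bcost b + t) s'"
    using exec.IfTrue[of b s \<Omega> g c t s' d] exec.IfFalse[of b s \<Omega> g d t s' c]
    by (cases "bval b s") simp_all
  ultimately show "wp \<Omega> g (If b c d) Q n s"
    unfolding wp_def using *
    by (intro exI[of _ "1 + bcost b + t"] exI[of _ s']) auto
qed

lemmas wp_simps = wp_Seq wp_If wp_exec[OF exec.Skip] wp_exec[OF exec.AssignNVar]
  wp_exec[OF exec.AssignNArr] wp_exec[OF exec.AssignRVar] wp_exec[OF exec.AssignRArr]
  wp_exec[OF exec.Query]

section \<open>Counting loops\<close>

definition for_loop :: "vname \<Rightarrow> nexp \<Rightarrow> com \<Rightarrow> com" where
  "for_loop x e c = Seq (AssignNVar x e)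
     (While (BNot (NLess (NVar ''K'') (NVar x)))
       (Seq c (AssignNVar x (NPlus (NVar x) (NConst 1)))))"

text \<open>Each iteration costs 5 for the test, at most \<open>C\<close> for the body and 4 for the
  increment; leaving costs one more test.\<close>

lemma exec_for_while:
  assumes "I i s" "i \<le> Suc K"
    and vars: "\<And>i s. I i s \<Longrightarrow> nvar s x = i \<and> nvar s ''K'' = K"
    and body: "\<And>i s. I i s \<Longrightarrow> i \<le> K \<Longrightarrow>
      wp \<Omega> g c (\<lambda>_ s. I (Suc i) (s\<lparr>nvar := (nvar s)(x := Suc (nvar s x))\<rparr>)) C s"
  shows "\<exists>t s'. exec \<Omega> g (While (BNot (NLess (NVar ''K'') (NVar x)))
       (Seq c (AssignNVar x (NPlus (NVar x) (NConst 1))))) s t s' \<and>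
     t \<le> (Suc K - i) * (C + 9) + 5 \<and> I (Suc K) s'"
  (is "\<exists>t s'. exec \<Omega> g (While ?b ?c) s t s' \<and> _ i t \<and> _ s'")
  using assms(1,2)
proof (induction "Suc K - i" arbitrary: i s)
  case 0
  then have i: "i = Suc K" by simp
  then have "\<not> bval ?b s" using vars[OF 0(2)] by simp
  from exec.WhileFalse[OF this] show ?case using 0 i
    by (intro exI[of _ "1 + bcost ?b"] exI[of _ s]) simp
next
  case (Suc k)
  then have i: "i \<le> K" by simp
  then have b: "bval ?b s" using vars[OF Suc(3)] by simp
  obtain t s1 where t: "exec \<Omega> g c s t s1" "t \<le> C"
    "I (Suc i) (s1\<lparr>nvar := (nvar s1)(x := Suc (nvar s1 x))\<rparr>)" (is "I _ ?s2")
    using body[OF Suc(3) i] by (auto simp: wp_def)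
  obtain u s' where u: "exec \<Omega> g (While ?b ?c) ?s2 u s'" "u \<le> (Suc K - Suc i) * (C + 9) + 5" "I (Suc K) s'"
    using Suc(1)[OF _ t(3)] Suc(2) i by (metis Suc_diff_le diff_Suc_Suc nat.inject Suc_le_mono)
  have "exec \<Omega> g ?c s (t + 4) ?s2"
    using exec.Seq[OF t(1) exec.AssignNVar[of \<Omega> g x "NPlus (NVar x) (NConst 1)" s1]]
    by (simp add: eval_nat_numeral)
  from exec.WhileTrue[OF b this u(1)]
  have "exec \<Omega> g (While ?b ?c) s (1 + bcost ?b + (t + 4) + u) s'" .
  moreover have "Suc K - i = Suc (Suc K - Suc i)" using i by simp
  then have "1 + bcost ?b + (t + 4) + u \<le> (Suc K - i) * (C + 9) + 5"
    using t(2) u(2) by simp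
  ultimately show ?case using u(3) by blast
qed

text \<open>\<open>N\<close> is the budget reserved for what follows the loop. Starting at 1 or
  later gives at most \<open>K\<close> iterations; the constant 6 is the final test plus the initial
  assignment.\<close>

lemma wp_for_loop:
  assumes "I (nval e s) (s\<lparr>nvar := (nvar s)(x := nval e s)\<rparr>)" "1 \<le> nval e s" "nval e s \<le> Suc K"
    and "\<And>i s. I i s \<Longrightarrow> nvar s x = i \<and> nvar s ''K'' = K"
    and "\<And>i s. I i s \<Longrightarrow> i \<le> K \<Longrightarrow>
      wp \<Omega> g c (\<lambda>_ s. I (Suc i) (s\<lparr>nvar := (nvar s)(x := Suc (nvar s x))\<rparr>)) C s"
    and n: "N + K * (C + 9) + ncost e + 6 \<le> n"
    and Q: "\<And>m s. I (Suc K) s \<Longrightarrow> N \<le> m \<Longrightarrow> Q m s"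
  shows "wp \<Omega> g (for_loop x e c) Q n s"
proof -
  obtain t s' where t: "exec \<Omega> g (While (BNot (NLess (NVar ''K'') (NVar x)))
       (Seq c (AssignNVar x (NPlus (NVar x) (NConst 1)))))
       (s\<lparr>nvar := (nvar s)(x := nval e s)\<rparr>) t s'"
     "t \<le> (Suc K - nval e s) * (C + 9) + 5" "I (Suc K) s'"
    using exec_for_while[of I, OF assms(1,3-5)] by blast
  have "(Suc K - nval e s) * (C + 9) \<le> K * (C + 9)" using assms(2) by (intro mult_right_mono) auto
  then have le: "N + (1 + ncost e + t) \<le> n" using t(2) n by linarith
  have "exec \<Omega> g (for_loop x e c) s (1 + ncost e + t) s'"
    unfolding for_loop_def by (rule exec.Seq[OF exec.AssignNVar t(1)])
  moreover have "Q (n - (1 + ncost e + t)) s'" using Q[OF t(3)] le by simp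
  ultimately show ?thesis unfolding wp_def using le by (meson add_leD2)
qed

section \<open>The program\<close>

definition singleton_values :: com where
  "singleton_values = for_loop ''i'' (NConst 1)
     (Seq (AssignNArr ''s'' (NVar ''i'') (NConst 1))
     (Seq (Query ''x'' ''s'')
     (Seq (AssignRArr ''v'' (NVar ''i'') (RVar ''x''))
       (AssignNArr ''s'' (NVar ''i'') (NConst 0)))))"

text \<open>Users are numbered from 1, so \<open>b = 0\<close> means that no candidate has been found yet.\<close>
definition find_least :: com where
  "find_least = for_loop ''j'' (NConst 1)
     (If (BAnd (NLess (NArr ''s'' (NVar ''j'')) (NConst 1))
           (BNot (BAnd (NLess (NConst 0) (NVar ''b''))
              (BNot (RLess (RArr ''v'' (NVar ''j'')) (RArr ''v'' (NVar ''b'')))))))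
       (AssignNVar ''b'' (NVar ''j'')) Skip)"

definition selection_sort :: com where
  "selection_sort = for_loop ''i'' (NConst 1)
     (Seq (AssignNVar ''b'' (NConst 0))
     (Seq find_least
     (Seq (AssignNArr ''p'' (NVar ''i'') (NVar ''b''))
     (Seq (AssignNArr ''s'' (NVar ''b'') (NConst 1))
     (Seq (Query ''x'' ''s'')
       (AssignRArr ''G'' (NVar ''i'') (RVar ''x'')))))))"

definition find_rate :: com where
  "find_rate = for_loop ''j'' (NVar ''i'')
     (Seq (AssignRVar ''d'' (RPlus (RVar ''d'') ROne))
     (Seq (AssignRVar ''x'' (RDivide (RMinus (RArr ''G'' (NVar ''j'')) (RVar ''h'')) (RVar ''d'')))
       (If (RLess (RVar ''x'') (RVar ''l'')) (AssignRVar ''l'' (RVar ''x'')) Skip)))"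

definition greedy_allocation :: com where
  "greedy_allocation = for_loop ''i'' (NConst 1)
     (Seq (AssignRVar ''l'' (RMinus (RArr ''G'' (NVar ''i'')) (RVar ''h'')))
     (Seq (AssignRVar ''d'' RZero)
     (Seq find_rate
     (Seq (AssignRArr ''r'' (NArr ''p'' (NVar ''i'')) (RVar ''l''))
       (AssignRVar ''h'' (RPlus (RVar ''h'') (RVar ''l'')))))))"

definition program :: com where
  "program = Seq singleton_values (Seq selection_sort greedy_allocation)"

section \<open>Correctness and running time of the phases\<close>

lemma wp_singleton_values:
  assumes "nvar s ''K'' = K" "1 \<le> K" "\<And>a. narr s ''s'' a = 0" "rvar s ''h'' = 0"
    and "N + 30 * K \<le> n"
    and Q: "\<And>m s'. \<lbrakk>N \<le> m; nvar s' ''K'' = K; \<And>a. narr s' ''s'' a = 0; rvar s' ''h'' = 0;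
      \<And>a. \<lbrakk>1 \<le> a; a \<le> K\<rbrakk> \<Longrightarrow> rarr s' ''v'' a = g {a}\<rbrakk> \<Longrightarrow> Q m s'"
  shows "wp {1..K} g singleton_values Q n s"
  unfolding singleton_values_def
proof (rule wp_for_loop[where C = 14 and N = N and K = K and
    I = "\<lambda>i s. nvar s ''i'' = i \<and> nvar s ''K'' = K \<and> (\<forall>a. narr s ''s'' a = 0) \<and> rvar s ''h'' = 0 \<and>
      1 \<le> i \<and> (\<forall>a. 1 \<le> a \<and> a < i \<longrightarrow> rarr s ''v'' a = g {a})"], goal_cases)
  case (5 i s)
  \<comment> \<open>All marks were zero before user \<open>i\<close> was marked, so the oracle is
    asked for exactly \<open>{i}\<close>. The body costs 10, within \<open>C = 14\<close>, and
    \<open>23 * K + 7 \<le> 30 * K\<close>.\<close>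
  then have "{a. (a = i \<longrightarrow> Suc 0 \<le> i \<and> i \<le> K) \<and> a = i} = {i}" "{a \<in> {1..K}. a = i} = {i}" by auto
  with 5 show ?case
    by (auto simp add: wp_simps less_Suc_eq)
qed (use assms in auto)

text \<open>Invariant of \<open>find_least\<close>: \<open>u\<close> holds the marks,
  \<open>v\<close> the keys, and \<open>b\<close> is the best candidate below
  \<open>j\<close>.\<close>

definition least_unmarked :: "(nat \<Rightarrow> nat) \<Rightarrow> (nat \<Rightarrow> real) \<Rightarrow> nat \<Rightarrow> nat \<Rightarrow> bool" where
  "least_unmarked u v j b \<longleftrightarrow>
     (if b = 0 then \<forall>a. 1 \<le> a \<and> a < j \<longrightarrow> u a \<noteq> 0
      else b < j \<and> u b = 0 \<and> (\<forall>a. 1 \<le> a \<and> a < j \<and> u a = 0 \<longrightarrow> v b \<le> v a))"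

text \<open>The condition copies the guard in \<open>find_least\<close>, so the two implications
  settle the two branches of its conditional.\<close>

lemma least_unmarked_Suc:
  assumes "least_unmarked u v j b" "1 \<le> j"
  shows "(u j < 1 \<and> \<not> (0 < b \<and> \<not> v j < v b) \<longrightarrow> least_unmarked u v (Suc j) j) \<and>
    (\<not> (u j < 1 \<and> \<not> (0 < b \<and> \<not> v j < v b)) \<longrightarrow> least_unmarked u v (Suc j) b)"
proof (cases "b = 0")
  case True
  then show ?thesis using assms by (auto simp: least_unmarked_def less_Suc_eq)
next
  case False
  then have b: "b < j" "u b = 0" and least: "\<And>a. \<lbrakk>1 \<le> a; a < j; u a = 0\<rbrakk> \<Longrightarrow> v b \<le> v a"
    using assms(1) by (auto simp: least_unmarked_def)
  then have "v j \<le> v a" if "v j < v b" "1 \<le> a" "a < j" "u a = 0" for a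
    using least[OF that(2-4)] that(1) by linarith
  then show ?thesis using assms(2) b least False by (auto simp: least_unmarked_def less_Suc_eq)
qed

text \<open>The assumed unmarked user excludes the outcome \<open>b = 0\<close>. The equalities in
  \<open>Q\<close> are frame conditions for the enclosing loop. The body costs at most 19, within
  \<open>C = 25\<close>.\<close>

lemma wp_find_least:
  assumes "nvar s ''K'' = K" "nvar s ''b'' = 0"
    and "\<exists>a. 1 \<le> a \<and> a \<le> K \<and> narr s ''s'' a = 0"
    and "N + 40 * K + 10 \<le> n"
    and Q: "\<And>m s'. \<lbrakk>N \<le> m; \<And>y. y \<notin> {''j'', ''b''} \<Longrightarrow> nvar s' y = nvar s y; narr s' = narr s;
      rvar s' = rvar s; rarr s' = rarr s;
      1 \<le> nvar s' ''b''; nvar s' ''b'' \<le> K; narr s ''s'' (nvar s' ''b'') = 0;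
      \<And>a. \<lbrakk>1 \<le> a; a \<le> K; narr s ''s'' a = 0\<rbrakk> \<Longrightarrow>
        rarr s ''v'' (nvar s' ''b'') \<le> rarr s ''v'' a\<rbrakk> \<Longrightarrow> Q m s'"
  shows "wp \<Omega> g find_least Q n s"
  unfolding find_least_def
proof (rule wp_for_loop[where C = 25 and N = N and K = K and
    I = "\<lambda>j s'. nvar s' ''j'' = j \<and> (\<forall>y. y \<noteq> ''j'' \<and> y \<noteq> ''b'' \<longrightarrow> nvar s' y = nvar s y) \<and>
      narr s' = narr s \<and> rvar s' = rvar s \<and> rarr s' = rarr s \<and> 1 \<le> j \<and>
      least_unmarked (narr s ''s'') (rarr s ''v'') j (nvar s' ''b'')"], goal_cases)
  case 1
  show ?case using assms by (auto simp: least_unmarked_def)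
next
  case (5 j s')
  then have "1 \<le> j" "least_unmarked (narr s ''s'') (rarr s ''v'') j (nvar s' ''b'')" by blast+
  from least_unmarked_Suc[OF this(2,1)] 5 show ?case by (simp add: wp_simps)
next
  case (7 m s')
  then show ?case using assms(3)
    by (intro Q) (auto simp: least_unmarked_def less_Suc_eq_le split: if_splits)
qed (use assms in auto)

text \<open>Naturals cannot be converted to reals, so \<open>d\<close> counts the distance as a
  real; it is raised before each division and then equals \<open>Suc j - i\<close>. The initial
  \<open>l\<close> is the slope for \<open>b = i\<close>, so the running minimum is attained from
  the start.\<close>

lemma wp_find_rate:
  assumes "nvar s ''K'' = K" "nvar s ''i'' = i" "rvar s ''d'' = 0" "1 \<le> i" "i \<le> K"
    and l: "rvar s ''l'' = rarr s ''G'' i - rvar s ''h''"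
    and "N + 40 * K + 10 \<le> n"
    and Q: "\<And>m s'. \<lbrakk>N \<le> m; \<And>y. y \<noteq> ''j'' \<Longrightarrow> nvar s' y = nvar s y; narr s' = narr s;
      \<And>y. y \<notin> {''d'', ''x'', ''l''} \<Longrightarrow> rvar s' y = rvar s y; rarr s' = rarr s;
      \<And>b. \<lbrakk>i \<le> b; b \<le> K\<rbrakk> \<Longrightarrow> rvar s' ''l'' \<le> (rarr s ''G'' b - rvar s ''h'') / real (Suc b - i);
      \<exists>b. i \<le> b \<and> b \<le> K \<and>
        rvar s' ''l'' = (rarr s ''G'' b - rvar s ''h'') / real (Suc b - i)\<rbrakk> \<Longrightarrow> Q m s'"
  shows "wp \<Omega> g find_rate Q n s"
proof -
  define f where "f b = (rarr s ''G'' b - rvar s ''h'') / real (Suc b - i)" for b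
  show ?thesis
    unfolding find_rate_def
  proof (rule wp_for_loop[where C = 25 and N = N and K = K and
      I = "\<lambda>j s'. nvar s' ''j'' = j \<and> (\<forall>y. y \<noteq> ''j'' \<longrightarrow> nvar s' y = nvar s y) \<and> narr s' = narr s \<and>
        (\<forall>y. y \<noteq> ''d'' \<and> y \<noteq> ''x'' \<and> y \<noteq> ''l'' \<longrightarrow> rvar s' y = rvar s y) \<and> rarr s' = rarr s \<and> i \<le> j \<and>
        rvar s' ''d'' = real (j - i) \<and> (\<forall>b. i \<le> b \<and> b < j \<longrightarrow> rvar s' ''l'' \<le> f b) \<and>
        (\<exists>b. i \<le> b \<and> b \<le> K \<and> rvar s' ''l'' = f b)"], goal_cases)
    case 1
    show ?case using assms by (auto simp: f_def intro!: exI[of _ i])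
  next
    case (5 j s')
    then have d: "real (Suc j - i) = real (j - i) + 1" by linarith
    have fj: "(rarr s ''G'' j - rvar s ''h'') / (real (j - i) + 1) = f j"
      unfolding f_def d ..
    from 5 d fj show ?case
      by (simp add: wp_simps less_Suc_eq del: of_nat_diff of_nat_Suc) (smt (verit))
  next
    case (7 m s')
    then show ?case by (intro Q) (auto simp: less_Suc_eq_le f_def)
  qed (use assms in auto)
qed

text \<open>Ties between equal keys are left open. Only positions up to \<open>a\<close> matter, so
  later writes into \<open>p\<close> preserve it.\<close>

definition selects :: "nat \<Rightarrow> (nat \<Rightarrow> real) \<Rightarrow> (nat \<Rightarrow> nat) \<Rightarrow> nat \<Rightarrow> bool" where
  "selects K v p a \<longleftrightarrow> p a \<in> {1..K} - p ` {1..<a} \<and> (\<forall>x \<in> {1..K} - p ` {1..<a}. v (p a) \<le> v x)"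

lemma image_upd_below: "a \<le> i \<Longrightarrow> (p(i := b)) ` {1..<a} = p ` {1..<a}" for i :: nat
  by auto

lemma selects_upd: "a < i \<Longrightarrow> selects K v (p(i := b)) a \<longleftrightarrow> selects K v p a"
  unfolding selects_def by (simp only: image_upd_below) simp

lemma exists_unmarked:
  fixes p :: "nat \<Rightarrow> nat"
  assumes "i \<le> K" "1 \<le> i"
  shows "\<exists>a \<in> {1..K}. a \<notin> p ` {1..<i}"
proof (rule ccontr)
  assume "\<not> ?thesis"
  then have "{1..K} \<subseteq> p ` {1..<i}" by blast
  then have "card {1..K} \<le> card (p ` {1..<i})" by (intro card_mono) auto
  also have "\<dots> \<le> card {1..<i}" by (intro card_image_le) simp
  finally show False using assms by simp
qed

text \<open>Shared by both nested loops: \<open>40 * K + 40\<close> bounds a body containing one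
  inner loop, 9 is the overhead per iteration, and 7 pays for initialisation and the final
  test.\<close>

lemma nested_loop_budget:
  fixes K :: nat
  assumes "1 \<le> K"
  shows "K * (40 * K + 40 + 9) + 7 \<le> 100 * (K * K)"
proof -
  have "K \<le> K * K" using assms by simp
  moreover have "K * (40 * K + 40 + 9) = 40 * (K * K) + 49 * K" by algebra
  ultimately show ?thesis using assms by linarith
qed

text \<open>The marks in \<open>s\<close> serve twice: they exclude users already placed, and they
  are the membership vector of the current prefix, so one query per position yields
  \<open>G\<close>.\<close>

lemma wp_selection_sort:
  assumes "nvar s ''K'' = K" "1 \<le> K" "\<And>a. narr s ''s'' a = 0" "rvar s ''h'' = 0"
    and n: "N + 100 * (K * K) \<le> n"
    and Q: "\<And>m s'. \<lbrakk>N \<le> m; nvar s' ''K'' = K; rvar s' ''h'' = 0;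
      \<And>a. \<lbrakk>1 \<le> a; a \<le> K\<rbrakk> \<Longrightarrow> selects K (rarr s ''v'') (narr s' ''p'') a;
      \<And>a. \<lbrakk>1 \<le> a; a \<le> K\<rbrakk> \<Longrightarrow> rarr s' ''G'' a = g (narr s' ''p'' ` {1..a})\<rbrakk> \<Longrightarrow> Q m s'"
  shows "wp {1..K} g selection_sort Q n s"
proof -
  define v where "v = rarr s ''v''"
  have n': "N + K * (40 * K + 40 + 9) + ncost (NConst 1) + 6 \<le> n"
    using n nested_loop_budget[OF assms(2)] by simp
  show ?thesis
    unfolding selection_sort_def
  proof (rule wp_for_loop[where C = "40 * K + 40" and N = N and K = K and
      I = "\<lambda>i s'. nvar s' ''i'' = i \<and> nvar s' ''K'' = K \<and> rvar s' ''h'' = 0 \<and> rarr s' ''v'' = v \<and>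
        1 \<le> i \<and> (\<forall>a. narr s' ''s'' a = 0 \<longleftrightarrow> a \<notin> narr s' ''p'' ` {1..<i}) \<and>
        (\<forall>a. 1 \<le> a \<and> a < i \<longrightarrow> selects K v (narr s' ''p'') a \<and>
           rarr s' ''G'' a = g (narr s' ''p'' ` {1..<Suc a}))"], goal_cases)
    case 1
    show ?case using assms by (simp add: v_def)
  next
    case (5 i s1)
    define p where "p = narr s1 ''p''"
    have i: "nvar s1 ''i'' = i" "nvar s1 ''K'' = K" "rvar s1 ''h'' = 0" "rarr s1 ''v'' = v" "1 \<le> i"
        "i \<le> K"
      and mark: "\<And>a. narr s1 ''s'' a = 0 \<longleftrightarrow> a \<notin> p ` {1..<i}"
      and sel: "\<And>a. \<lbrakk>1 \<le> a; a < i\<rbrakk> \<Longrightarrow> selects K v p a"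
      and G: "\<And>a. \<lbrakk>1 \<le> a; a < i\<rbrakk> \<Longrightarrow> rarr s1 ''G'' a = g (p ` {1..<Suc a})"
      using 5 unfolding p_def by blast+
    \<comment> \<open>Resetting \<open>b\<close> has used 2 of the \<open>40 * K + 40\<close> units.
      The search takes at most \<open>40 * K + 10\<close> and leaves 28 for the remaining
      assignments and the query, which cost 10.\<close>
    have fl: "wp {1..K} g find_least Q' n' s'"
      if "n' = 40 * K + 38" "s' = s1\<lparr>nvar := (nvar s1)(''b'' := 0)\<rparr>" and Q': "\<And>m s2 b. \<lbrakk>28 \<le> m; nvar s2 ''b'' = b; nvar s2 ''i'' = i; nvar s2 ''K'' = K; narr s2 = narr s1;
        rvar s2 = rvar s1; rarr s2 = rarr s1; selects K v (p(i := b)) i\<rbrakk> \<Longrightarrow> Q' m s2" for Q' n' s'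
    proof (rule wp_find_least[where K = K and N = 28], goal_cases)
      case 3
      show ?case using that(2) exists_unmarked[OF i(6,5), of p] mark by auto
    next
      case (5 m s2)
      show ?case
      proof (rule Q'[OF 5(1) refl])
        show "selects K v (p(i := nvar s2 ''b'')) i"
          using 5(6-9) that(2) i(4) mark unfolding selects_def image_upd_below[OF order_refl] by auto
      qed (use 5 that(2) i in simp_all)
    qed (use that(1,2) i in simp_all)
    show ?case
      unfolding wp_Seq wp_exec[OF exec.AssignNVar]
    proof (intro conjI fl, goal_cases)
      case (4 m s2 b)
      note 1 = this
      define p' where "p' = p(i := b)"
      have img: "p' ` {1..<Suc i} = insert b (p ` {1..<i})"
        using i(5) by (auto simp: p'_def atLeastLessThanSuc)
      have sel': "selects K v p' a" if "1 \<le> a" "a < Suc i" for a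
        using that 1(8) sel selects_upd[of a i K v p b] by (cases "a = i") (auto simp: p'_def)
      \<comment> \<open>The oracle sees only marks inside \<open>{1..K}\<close>, so the queried set
        is the whole prefix.\<close>
      have "p' ` {1..<Suc i} \<subseteq> {1..K}"
        using sel' unfolding selects_def by force
      then have set: "{x \<in> {1..K}. ((narr s1 ''s'')(b := Suc 0)) x \<noteq> 0} = p' ` {1..<Suc i}"
        using img mark by (auto simp flip: neq0_conv)
      have G': "g (p' ` {1..<Suc a}) = rarr s1 ''G'' a" if "1 \<le> a" "a < i" for a
        using G[OF that] image_upd_below[of "Suc a" i p b] that by (simp add: p'_def)
      have p'_eq: "(narr s1 ''p'')(i := b) = p'" by (simp add: p'_def p_def)
      show ?case using 1(1-7) i(1-4) set
        by (simp add: wp_simps p'_eq sel' img[unfolded One_nat_def] mark[unfolded One_nat_def])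
          (auto simp: G'[unfolded One_nat_def] less_Suc_eq)
    qed simp_all
  next
    case (7 m s')
    then show ?case by (intro Q) (auto simp: v_def atLeastLessThanSuc_atLeastAtMost)
  qed (use assms n' in auto)
qed

text \<open>The conditions \<open>bound\<close> and \<open>attained\<close> of
  \<open>greedy_rates\<close> at a single \<open>a\<close>, with stored values \<open>G\<close> for
  the prefixes.\<close>

definition greedy_step :: "nat \<Rightarrow> (nat \<Rightarrow> real) \<Rightarrow> (nat \<Rightarrow> real) \<Rightarrow> nat \<Rightarrow> bool" where
  "greedy_step K G l a \<longleftrightarrow>
     (\<forall>b. a < b \<and> b \<le> K \<longrightarrow> (\<Sum>c=1..a. l c) + real (b - a) * l (Suc a) \<le> G b) \<and>
     (\<exists>b. a < b \<and> b \<le> K \<and> (\<Sum>c=1..a. l c) + real (b - a) * l (Suc a) = G b)"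

lemma greedy_step_cong:
  assumes "\<And>c. \<lbrakk>1 \<le> c; c \<le> Suc a\<rbrakk> \<Longrightarrow> l c = l' c"
  shows "greedy_step K G l a \<longleftrightarrow> greedy_step K G l' a"
proof -
  have "(\<Sum>c=1..a. l c) = (\<Sum>c=1..a. l' c)" using assms by (intro sum.cong) auto
  then show ?thesis using assms[of "Suc a"] by (simp add: greedy_step_def)
qed

text \<open>Rates are stored under the user \<open>p i\<close>, so injectivity of \<open>p\<close>
  ensures that a write leaves the rates of earlier positions, and hence their greedy steps,
  intact.\<close>

lemma wp_greedy_allocation:
  assumes "nvar s ''K'' = K" "1 \<le> K" "rvar s ''h'' = 0" and inj: "inj_on (narr s ''p'') {1..K}"
    and n: "100 * (K * K) \<le> n"
    and Q: "\<And>m s'. \<lbrakk>\<And>a. a < K \<Longrightarrow>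
      greedy_step K (rarr s ''G'') (\<lambda>c. rarr s' ''r'' (narr s ''p'' c)) a\<rbrakk> \<Longrightarrow> Q m s'"
  shows "wp \<Omega> g greedy_allocation Q n s"
proof -
  define p where "p = narr s ''p''"
  define G where "G = rarr s ''G''"
  have n': "0 + K * (40 * K + 40 + 9) + ncost (NConst 1) + 6 \<le> n"
    using n nested_loop_budget[OF assms(2)] by simp
  show ?thesis
    unfolding greedy_allocation_def
  proof (rule wp_for_loop[where C = "40 * K + 40" and N = 0 and K = K and
      I = "\<lambda>i s'. nvar s' ''i'' = i \<and> nvar s' ''K'' = K \<and> narr s' ''p'' = p \<and> rarr s' ''G'' = G \<and>
        1 \<le> i \<and> rvar s' ''h'' = (\<Sum>c\<in>{1..<i}. rarr s' ''r'' (p c)) \<and>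
        (\<forall>a. Suc a < i \<longrightarrow> greedy_step K G (\<lambda>c. rarr s' ''r'' (p c)) a)"], goal_cases)
    case 1
    show ?case using assms by (simp add: p_def G_def)
  next
    case (5 i s1)
    define r where "r = rarr s1 ''r''"
    have i: "nvar s1 ''i'' = i" "nvar s1 ''K'' = K" "narr s1 ''p'' = p" "rarr s1 ''G'' = G" "1 \<le> i"
        "i \<le> K" "rvar s1 ''h'' = (\<Sum>c\<in>{1..<i}. r (p c))"
      and step: "\<And>a. Suc a < i \<Longrightarrow> greedy_step K G (\<lambda>c. r (p c)) a"
      using 5 unfolding r_def by blast+
    obtain a where a: "i = Suc a" using i(5) by (cases i) auto
    have upd: "(r(p i := l)) (p c) = r (p c)" if "1 \<le> c" "c < i" for c l
      using inj_onD[OF inj, of c i] that i(6) by (auto simp: p_def)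
    have sum_upd: "(\<Sum>c\<in>{1..<i}. (r(p i := l)) (p c)) = (\<Sum>c\<in>{1..<i}. r (p c))" for l
      using upd by (intro sum.cong) auto
    define h where "h = (\<Sum>c\<in>{1..<i}. r (p c))"
    \<comment> \<open>The two initial assignments cost 5 and 2. The search leaves at least 21 units,
      of which the last two assignments use 8.\<close>
    have fr: "wp \<Omega> g find_rate Q' n' s'"
      if n2: "n' = 40 * K + 33" and st: "s' = s1\<lparr>rvar := (rvar s1)(''l'' := G i - h, ''d'' := 0)\<rparr>" and Q': "\<And>m s2 l. \<lbrakk>21 \<le> m; nvar s2 ''i'' = i; nvar s2 ''K'' = K; narr s2 = narr s1;
        rvar s2 ''l'' = l; rvar s2 ''h'' = h; rarr s2 = rarr s1;
        greedy_step K G (\<lambda>c. (r(p i := l)) (p c)) a\<rbrakk> \<Longrightarrow> Q' m s2" for Q' n' s'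
    proof (rule wp_find_rate[where K = K and N = 21 and i = i], goal_cases)
      case (8 m s2)
      show ?case
      proof (rule Q'[OF 8(1) _ _ _ refl])
        have eq: "(\<Sum>c=1..a. (r(p i := l)) (p c)) = h" for l
          using sum_upd[of l] a by (simp add: h_def atLeastLessThanSuc_atLeastAtMost)
        show "greedy_step K G (\<lambda>c. (r(p i := rvar s2 ''l'')) (p c)) a"
          unfolding greedy_step_def eq
        proof (intro conjI allI impI)
          \<comment> \<open>With \<open>i = Suc a\<close>, the divisor \<open>Suc b - i\<close> of
            \<open>find_rate\<close> is \<open>b - a\<close>.\<close>
          fix b assume b: "a < b \<and> b \<le> K"
          then have "rvar s2 ''l'' \<le> (G b - h) / real (b - a)"
            using 8(6)[of b] st a i h_def by simp
          then show "h + real (b - a) * (r(p i := rvar s2 ''l'')) (p (Suc a)) \<le> G b"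
            using b a by (simp add: field_simps del: of_nat_diff)
        next
          obtain b where b: "i \<le> b" "b \<le> K" "rvar s2 ''l'' = (G b - h) / real (b - a)"
            using 8(7) st a i h_def by auto
          then have "h + real (b - a) * (r(p i := rvar s2 ''l'')) (p (Suc a)) = G b"
            using a by (simp add: field_simps del: of_nat_diff)
          then show "\<exists>b. a < b \<and> b \<le> K \<and>
              h + real (b - a) * (r(p i := rvar s2 ''l'')) (p (Suc a)) = G b"
            using b a by (intro exI[of _ b]) simp
        qed
      qed (use 8 st i h_def in simp_all)
    qed (use n2 st i h_def in simp_all)
    show ?case
      unfolding wp_Seq wp_exec[OF exec.AssignRVar]
    proof (intro conjI fr, goal_cases)
      case (5 m s2 l)
      note 1 = this
      have step': "greedy_step K G (\<lambda>c. (r(p i := l)) (p c)) a'" if "Suc a' < Suc i" for a'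
      proof (cases "a' = a")
        case False
        then have "Suc a' < i" using that a by simp
        then show ?thesis using step[of a'] upd[of _ l]
          by (subst greedy_step_cong[where l' = "\<lambda>c. r (p c)"]) auto
      qed (use 1 in simp)
      show ?case using 1(1-7) i step' sum_upd[of l]
        by (simp add: wp_simps h_def flip: r_def)
    qed (use i h_def in simp_all)
  next
    case (7 m s')
    then show ?case by (intro Q) (auto simp: p_def G_def)
  qed (use assms n' in auto)
qed

section \<open>Composition of the phases\<close>

lemma program_correct:
  assumes "1 \<le> K" and nonneg: "\<forall>S\<subseteq>{1..K}. 0 \<le> g S"
    and order: "order_property_on {1..K} g" and sub: "submodular_on {1..K} g"
  shows "wp {1..K} g program
    (\<lambda>_ s. max_min_fair {1..K} (rate_region {1..K} g) (output_point K s)) (230 * K\<^sup>2) (input_memory K)"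
proof -
  \<comment> \<open>The phases take at most \<open>30 * K\<close>, \<open>100 * (K * K)\<close> and
    \<open>100 * (K * K)\<close> units; this inequality fits the first into
    \<open>30 * (K * K)\<close>.\<close>
  have K: "K \<le> K * K" using assms(1) by simp
  show ?thesis
    unfolding program_def wp_Seq
  proof (rule wp_singleton_values[where N = "200 * (K * K)"], goal_cases)
    case (6 m s1)
    note v = 6(5)
    show ?case
    proof (rule wp_selection_sort[where N = "100 * (K * K)"], goal_cases)
      case (6 m' s2)
      define p where "p = narr s2 ''p''"
      have sel: "selects K (rarr s1 ''v'') p a" if "1 \<le> a" "a \<le> K" for a
        using 6(4)[OF that] by (simp add: p_def)
      have "p a \<noteq> p b" if "1 \<le> a" "a < b" "b \<le> K" for a b
      proof -
        have "p a \<in> p ` {1..<b}" using that by simp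
        moreover have "p b \<notin> p ` {1..<b}" using sel[of b] that unfolding selects_def by simp
        ultimately show ?thesis by metis
      qed
      then have inj: "inj_on p {1..K}"
        by (intro inj_onI) (metis atLeastAtMost_iff linorder_neqE_nat)
      have "p ` {1..K} \<subseteq> {1..K}" using sel unfolding selects_def by (intro image_subsetI) simp
      then have bij: "bij_betw p {1..K} {1..K}"
        using inj endo_inj_surj[of "{1..K}" p] by (simp add: bij_betw_def)
      have sorted: "g {p a} \<le> g {p b}" if ab: "1 \<le> a" "a \<le> b" "b \<le> K" for a b
      proof -
        have pa: "p a \<in> {1..K}" and pb: "p b \<in> {1..K}" "p b \<notin> p ` {1..<b}"
          using sel[of a] sel[of b] ab unfolding selects_def by auto
        \<comment> \<open>User \<open>p b\<close> was still available when \<open>p a\<close> was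
          selected, so its key is no smaller.\<close>
        have "p b \<notin> p ` {1..<a}" using pb(2) ab(2) by auto
        with pb(1) have "rarr s1 ''v'' (p a) \<le> rarr s1 ''v'' (p b)"
          using sel[of a] ab unfolding selects_def by auto
        then show ?thesis using pa pb v by simp
      qed
      show ?case
      proof (rule wp_greedy_allocation[where K = K], goal_cases)
        case (6 m'' s3)
        define l where "l c = rarr s3 ''r'' (p c)" for c
        have step: "greedy_step K (rarr s2 ''G'') l a" if "a < K" for a
          using 6[OF that] by (simp add: p_def l_def[abs_def])
        have G: "\<And>a. \<lbrakk>1 \<le> a; a \<le> K\<rbrakk> \<Longrightarrow> rarr s2 ''G'' a = g (p ` {1..a})"
          unfolding p_def by fact
        interpret greedy_rates K g p l
        proof
          fix a b assume ab: "a < b" "b \<le> K"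
          show "(\<Sum>c=1..a. l c) + real (b - a) * l (Suc a) \<le> g (p ` {1..b})"
            using step[of a] ab G[of b] unfolding greedy_step_def by auto
        next
          fix a assume a: "a < K"
          obtain b where "a < b" "b \<le> K" "(\<Sum>c=1..a. l c) + real (b - a) * l (Suc a) = rarr s2 ''G'' b"
            using step[OF a] unfolding greedy_step_def by blast
          then show "\<exists>b. a < b \<and> b \<le> K \<and> (\<Sum>c=1..a. l c) + real (b - a) * l (Suc a) = g (p ` {1..b})"
            using G[of b] by (intro exI[of _ b]) simp
        qed (use nonneg in blast, rule order, rule sub, rule bij, rule sorted)
        show ?case
          unfolding output_point_def by (rule max_min_fair_r) (simp add: l_def)
      qed (use 6 inj assms(1) in \<open>simp_all add: p_def\<close>)
    qed (use 6 assms(1) in simp_all)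
  qed (use assms(1) K in \<open>simp_all add: input_memory_def power2_eq_square\<close>)
qed

theorem proposition21:
  shows "\<exists>(c::com) (T::nat \<Rightarrow> nat).
    (\<lambda>K. real (T K)) \<in> O(\<lambda>K. real K ^ 2) \<and>
    (\<forall>(K::nat) (g::nat set \<Rightarrow> real).
       1 \<le> K \<longrightarrow>
       (\<forall>S\<subseteq>{1..K}. 0 \<le> g S) \<longrightarrow>
       order_property_on {1..K} g \<longrightarrow>
       submodular_on {1..K} g \<longrightarrow>
       (\<exists>t s. exec {1..K} g c (input_memory K) t s \<and> t \<le> T K \<and>
              max_min_fair {1..K} (rate_region {1..K} g) (output_point K s)))"
proof (rule exI[of _ program], rule exI[of _ "\<lambda>K. 230 * K\<^sup>2"], intro conjI allI impI)
  show "(\<lambda>K. real (230 * K\<^sup>2)) \<in> O(\<lambda>K. real K ^ 2)" by simp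
  fix K g
  assume "1 \<le> K" "\<forall>S\<subseteq>{1..K}. 0 \<le> g S" "order_property_on {1..K} g" "submodular_on {1..K} g"
  from program_correct[OF this]
  show "\<exists>t s. exec {1..K} g program (input_memory K) t s \<and> t \<le> 230 * K\<^sup>2 \<and>
      max_min_fair {1..K} (rate_region {1..K} g) (output_point K s)"
    unfolding wp_def by blast
qed

end
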